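(* For each prime $p$, there is an uncountable set of totally disconnected, locally compact contraction groups $(H,\beta)$ which are pairwise non-isomorphic as contraction groups and such that each $(H,\beta)$ is a central extension of contraction groups $$\{0\}\to \mathbb{F}_p((t))\to H\to \mathbb{F}_p((t))\to\{0\}.$$
   Context: A locally compact contraction group is a pair $(G,\alpha)$ where $G$ is a (Hausdorff) locally compact group and $\alpha\colon G\to G$ is a bicontinuous automorphism with $\alpha^n(x)\to e$ as $n\to\infty$ for each $x\in G$. It is called totally disconnected if $G$ is so. A morphism $(G,\alpha_G)\to(H,\alpha_H)$ of contraction groups is a continuous group homomorphism $\phi\colon G\to H$ with $\alpha_H\circ\phi=\phi\circ\alpha_G$; an isomorphism is an invertible morphism whose inverse is a morphism. $\mathbb{F}_p((t))$ denotes the additive group of the field of formal Laurent series over $\mathbb{F}_p=\mathbb{Z}/p\mathbb{Z}$ with its usual locally compact topology, regarded as a contraction group with the contractive automorphism $f\mapsto tf$. An extension of contraction groups is a short exact sequence $\{e\}\to A\xrightarrow{\iota}\widehat{G}\xrightarrow{q}G\to\{e\}$ of totally disconnected, locally compact contraction groups in which $\iota$ and $q$ are morphisms of contraction groups; it is central if $\iota(A)$ is contained in the centre of $\widehat{G}$. *)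

theory Defs
  imports
    "HOL-Analysis.Analysis"
    "HOL-Algebra.Coset"
    "HOL-Computational_Algebra.Formal_Laurent_Series"
    "Berlekamp_Zassenhaus.Finite_Field"
begin

record 'a cgroup = "'a monoid" +
  topol :: "'a topology"
  aut :: "'a \<Rightarrow> 'a"

locale lc_contraction_group = group G for G :: "('a, 'b) cgroup_scheme" (structure) +
  assumes topspace_eq: "topspace (topol G) = carrier G"
    and mult_continuous:
      "continuous_map (prod_topology (topol G) (topol G)) (topol G) (\<lambda>(x, y). x \<otimes> y)"
    and inv_continuous: "continuous_map (topol G) (topol G) (\<lambda>x. inv x)"
    and Hausdorff: "Hausdorff_space (topol G)"
    and locally_compact: "locally_compact_space (topol G)"
    and aut_iso: "aut G \<in> iso G G"
    and aut_bicontinuous: "homeomorphic_map (topol G) (topol G) (aut G)"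
    and aut_contractive:
      "x \<in> carrier G \<Longrightarrow> limitin (topol G) (\<lambda>n. (aut G ^^ n) x) \<one> sequentially"

definition totally_disconnected_space :: "'a topology \<Rightarrow> bool" where
  "totally_disconnected_space X \<longleftrightarrow>
     (\<forall>x \<in> topspace X. connected_component_of_set X x = {x})"

locale tdlc_contraction_group = lc_contraction_group +
  assumes totally_disconnected: "totally_disconnected_space (topol G)"

definition cgroup_morphism ::
    "('a, 'c) cgroup_scheme \<Rightarrow> ('b, 'd) cgroup_scheme \<Rightarrow> ('a \<Rightarrow> 'b) \<Rightarrow> bool" where
  "cgroup_morphism G H \<phi> \<longleftrightarrow>
     \<phi> \<in> hom G H \<and> continuous_map (topol G) (topol H) \<phi> \<and>
     (\<forall>x \<in> carrier G. aut H (\<phi> x) = \<phi> (aut G x))"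

definition cgroup_isomorphic ::
    "('a, 'c) cgroup_scheme \<Rightarrow> ('b, 'd) cgroup_scheme \<Rightarrow> bool" where
  "cgroup_isomorphic G H \<longleftrightarrow>
     (\<exists>\<phi> \<psi>. cgroup_morphism G H \<phi> \<and> cgroup_morphism H G \<psi> \<and>
        (\<forall>x \<in> carrier G. \<psi> (\<phi> x) = x) \<and> (\<forall>y \<in> carrier H. \<phi> (\<psi> y) = y))"

text \<open>
  The library notion of a short exact sequence requires all groups to live on the same type,
  so exactness is spelled out here.
\<close>

definition cgroup_extension ::
    "('a, 'd) cgroup_scheme \<Rightarrow> ('b, 'e) cgroup_scheme \<Rightarrow> ('c, 'f) cgroup_scheme \<Rightarrow>
     ('a \<Rightarrow> 'b) \<Rightarrow> ('b \<Rightarrow> 'c) \<Rightarrow> bool" where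
  "cgroup_extension A E G \<iota> q \<longleftrightarrow>
     tdlc_contraction_group A \<and> tdlc_contraction_group E \<and> tdlc_contraction_group G \<and>
     cgroup_morphism A E \<iota> \<and> cgroup_morphism E G q \<and>
     inj_on \<iota> (carrier A) \<and> \<iota> ` carrier A = kernel E G q \<and> q ` carrier E = carrier G"

definition group_center :: "('a, 'b) monoid_scheme \<Rightarrow> 'a set" where
  "group_center G = {z \<in> carrier G. \<forall>x \<in> carrier G. z \<otimes>\<^bsub>G\<^esub> x = x \<otimes>\<^bsub>G\<^esub> z}"

definition central_cgroup_extension ::
    "('a, 'd) cgroup_scheme \<Rightarrow> ('b, 'e) cgroup_scheme \<Rightarrow> ('c, 'f) cgroup_scheme \<Rightarrow>
     ('a \<Rightarrow> 'b) \<Rightarrow> ('b \<Rightarrow> 'c) \<Rightarrow> bool" where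
  "central_cgroup_extension A E G \<iota> q \<longleftrightarrow>
     cgroup_extension A E G \<iota> q \<and> \<iota> ` carrier A \<subseteq> group_center E"

text \<open>
  For a type \<open>'p\<close> of class \<open>prime_card\<close>, the type \<open>'p mod_ring\<close> is the prime field with
  \<open>p = CARD('p)\<close> elements.  The type class topology on Laurent series is given by the metric
  \<open>dist f g = 2 powi (- n)\<close> for \<open>f \<noteq> g\<close>, with \<open>n\<close> the order of \<open>f - g\<close>.
\<close>

definition Fp_laurent :: "'p::prime_card mod_ring fls cgroup" where
  "Fp_laurent =
     \<lparr>carrier = UNIV, monoid.mult = (+), one = 0, topol = euclidean, aut = (\<lambda>f. fls_X * f)\<rparr>"

end

theory Submission
  imports Defs
begin

unbundle fps_syntax and no vec_syntax

text \<open>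
  For a power series \<open>s\<close>, let \<open>F\<^sub>p((t)) \<times> F\<^sub>p((t))\<close> carry the product
  \<open>(x, f) (y, g) = (x + y + (s f) \<odot> g, f + g)\<close>, where \<open>\<odot>\<close> multiplies coefficientwise.
  The cocycle is biadditive and continuous, and it commutes with the shift \<open>t\<close>.  If \<open>s \<noteq> 0\<close> has
  vanishing constant term, the centre is the first factor, so an isomorphism from the group of \<open>s\<close>
  to that of \<open>r\<close> induces shift-equivariant additive maps on the centre and on the quotient.
  Let \<open>u\<close> and \<open>v\<close> be the images of \<open>1\<close> under these maps.  Comparing the commutators of \<open>1\<close> and
  \<open>t^n\<close> coefficient by coefficient yields
  \<open>(r v)\<^sub>m v\<^sub>m\<^sub>-\<^sub>n = s\<^sub>n u\<^sub>m\<^sub>-\<^sub>n + (r v)\<^sub>m\<^sub>-\<^sub>n v\<^sub>m\<close>.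
  If both series begin with \<open>t + 0 t^2 + 0 t^3\<close>, this forces \<open>v\<close> to be a scalar multiple of a power
  of \<open>t\<close>, and then \<open>s = r\<close>.  There are uncountably many such series with coefficients in
  \<open>{0, 1}\<close>.
\<close>

section \<open>Topology of Laurent series\<close>

text \<open>Nonzero distances are powers of 2 read off from the order of \<open>f - g\<close>, so
  the strict bound says that this order exceeds \<open>n\<close>. All later limits are checked on
  coefficients through this.\<close>

lemma dist_fls_less_iff:
  fixes f g :: "'a::group_add fls"
  shows "dist f g < 2 powi (- n) \<longleftrightarrow> (\<forall>j\<le>n. f $$ j = g $$ j)"
proof (cases "f = g")
  case False
  define d where "d = fls_subdegree (f - g)"
  have "dist f g = 2 powi (- d)"
    using False by (simp add: dist_fls_def d_def power_int_def power_one_over inverse_eq_divide)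
  then have "dist f g < 2 powi (- n) \<longleftrightarrow> n < d"
    using power_int_strict_increasing[of "- d" "- n" "2 :: real"]
      power_int_increasing[of "- n" "- d" "2 :: real"] by linarith
  also have "\<dots> \<longleftrightarrow> (\<forall>j\<le>n. (f - g) $$ j = 0)"
    unfolding d_def
    using False by (metis fls_eq0_below_subdegree fls_subdegree_greaterI not_le
        nth_fls_subdegree_nonzero order_le_less_trans right_minus_eq)
  finally show ?thesis by simp
qed simp

lemma tendsto_fls_iff:
  fixes h :: "'b \<Rightarrow> 'a::group_add fls"
  shows "(h \<longlongrightarrow> l) F \<longleftrightarrow> (\<forall>n. \<forall>\<^sub>F x in F. \<forall>j\<le>n. h x $$ j = l $$ j)"
proof
  assume "(h \<longlongrightarrow> l) F"
  then have "\<forall>\<^sub>F x in F. dist (h x) l < 2 powi (- n)" for n :: int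
    by (simp add: tendsto_iff)
  then show "\<forall>n. \<forall>\<^sub>F x in F. \<forall>j\<le>n. h x $$ j = l $$ j"
    by (simp only: dist_fls_less_iff) blast
next
  assume *: "\<forall>n. \<forall>\<^sub>F x in F. \<forall>j\<le>n. h x $$ j = l $$ j"
  show "(h \<longlongrightarrow> l) F"
    unfolding tendsto_iff
  proof safe
    fix e :: real assume "e > 0"
    then obtain n where n: "(1/2) ^ n < e"
      using real_arch_pow_inv[of e "1/2"] by auto
    have "\<forall>\<^sub>F x in F. dist (h x) l < 2 powi (- int n)"
      unfolding dist_fls_less_iff using * by blast
    then show "\<forall>\<^sub>F x in F. dist (h x) l < e"
      by eventually_elim (use n in \<open>simp add: power_int_minus power_one_over inverse_eq_divide\<close>)
  qed
qed

lemma tendsto_fls_add: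
  fixes h k :: "'b \<Rightarrow> 'a::group_add fls"
  assumes "(h \<longlongrightarrow> a) F" "(k \<longlongrightarrow> b) F"
  shows "((\<lambda>x. h x + k x) \<longlongrightarrow> a + b) F"
  unfolding tendsto_fls_iff
proof
  fix n
  have "\<forall>\<^sub>F x in F. \<forall>j\<le>n. h x $$ j = a $$ j" "\<forall>\<^sub>F x in F. \<forall>j\<le>n. k x $$ j = b $$ j"
    using assms by (auto simp: tendsto_fls_iff)
  then show "\<forall>\<^sub>F x in F. \<forall>j\<le>n. (h x + k x) $$ j = (a + b) $$ j"
    by eventually_elim simp
qed

lemma tendsto_fls_minus:
  fixes h :: "'b \<Rightarrow> 'a::group_add fls"
  assumes "(h \<longlongrightarrow> a) F"
  shows "((\<lambda>x. - h x) \<longlongrightarrow> - a) F"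
  using assms by (simp add: tendsto_fls_iff)

lemma tendsto_fls_shift:
  fixes h :: "'b \<Rightarrow> 'a::group_add fls"
  assumes "(h \<longlongrightarrow> a) F"
  shows "((\<lambda>x. fls_shift k (h x)) \<longlongrightarrow> fls_shift k a) F"
  unfolding tendsto_fls_iff
proof
  fix n
  have "\<forall>\<^sub>F x in F. \<forall>j\<le>n + k. h x $$ j = a $$ j"
    using assms by (auto simp: tendsto_fls_iff)
  then show "\<forall>\<^sub>F x in F. \<forall>j\<le>n. fls_shift k (h x) $$ j = fls_shift k a $$ j"
    by eventually_elim simp
qed

text \<open>A power series has order at least 0, so multiplying by it never lowers the order of a
  difference: the product up to index \<open>n\<close> sees only the factor up to index
  \<open>n\<close>.\<close>

lemma tendsto_fls_fps_mult:
  fixes h :: "'b \<Rightarrow> 'a::ring fls"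
  assumes "(h \<longlongrightarrow> a) F"
  shows "((\<lambda>x. fps_to_fls s * h x) \<longlongrightarrow> fps_to_fls s * a) F"
  unfolding tendsto_fls_iff
proof
  fix n
  have eq: "(fps_to_fls s * f) $$ j = (fps_to_fls s * a) $$ j"
    if f: "\<forall>j\<le>n. f $$ j = a $$ j" and "j \<le> n" for f j
  proof (cases "f = a")
    case False
    have "n < fls_subdegree (f - a)"
      using f False by (intro fls_subdegree_greaterI) auto
    moreover have "fls_subdegree (fps_to_fls s) \<ge> 0"
      by (rule fls_subdegree_fls_to_fps_gt0)
    ultimately have "(fps_to_fls s * (f - a)) $$ j = 0"
      using \<open>j \<le> n\<close> by (intro fls_times_nth_eq0) linarith
    then show ?thesis by (simp add: right_diff_distrib)
  qed simp
  have "\<forall>\<^sub>F x in F. \<forall>j\<le>n. h x $$ j = a $$ j"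
    using assms by (auto simp: tendsto_fls_iff)
  then show "\<forall>\<^sub>F x in F. \<forall>j\<le>n. (fps_to_fls s * h x) $$ j = (fps_to_fls s * a) $$ j"
    by eventually_elim (use eq in blast)
qed

lemma tendsto_fls_X_power_mult:
  fixes f :: "'a::comm_ring_1 fls"
  shows "(\<lambda>n. fls_X ^ n * f) \<longlonglongrightarrow> 0"
  unfolding tendsto_fls_iff
proof
  fix N :: int
  show "\<forall>\<^sub>F n in sequentially. \<forall>j\<le>N. (fls_X ^ n * f) $$ j = 0 $$ j"
  proof (rule eventually_sequentiallyI)
    \<comment> \<open>Coefficient \<open>j\<close> of \<open>fls_X ^ n * f\<close> is coefficient
      \<open>j - n\<close> of \<open>f\<close>; from this bound on, that index lies below
      \<open>fls_subdegree f\<close>.\<close>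
    fix n assume "n \<ge> nat (N - fls_subdegree f + 1)"
    then show "\<forall>j\<le>N. (fls_X ^ n * f) $$ j = 0 $$ j"
      by (auto simp: fls_X_power_times_conv_shift)
  qed
qed

text \<open>Prescribing one coefficient gives a set that is open together with its complement, so a
  differing coefficient separates two series.\<close>

lemma connected_fls_eq:
  fixes S :: "'a::group_add fls set"
  assumes "connected S" "f \<in> S" "g \<in> S"
  shows "f = g"
proof (rule fls_eqI, rule ccontr)
  fix n assume ne: "f $$ n \<noteq> g $$ n"
  have op: "open {h :: 'a fls. P (h $$ n)}" for P
    unfolding open_dist
  proof
    fix h assume "h \<in> {h :: 'a fls. P (h $$ n)}"
    moreover have "h' $$ n = h $$ n" if "dist h' h < 2 powi (- n)" for h'
      using that unfolding dist_fls_less_iff by blast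
    moreover have "(0 :: real) < 2 powi (- n)" by simp
    ultimately show "\<exists>e>0. \<forall>y. dist y h < e \<longrightarrow> y \<in> {h. P (h $$ n)}"
      by (metis mem_Collect_eq)
  qed
  have "{h. h $$ n = f $$ n} \<inter> S = {} \<or> {h. h $$ n \<noteq> f $$ n} \<inter> S = {}"
    by (rule connectedD[OF assms(1) op op]) auto
  then show False
    using ne assms(2,3) by (metis (mono_tags, lifting) IntI empty_iff mem_Collect_eq)
qed

section \<open>Local compactness over a finite coefficient ring\<close>

text \<open>Completeness and total boundedness: since there are finitely many coefficient values,
  the truncations after index \<open>n\<close> form a finite net with distances below
  \<open>(1/2) ^ n\<close>.\<close>

lemma compact_fps_UNIV: "compact (UNIV :: 'a::{finite,comm_ring_1} fps set)"
  unfolding compact_eq_totally_bounded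
proof safe
  show "complete (UNIV :: 'a fps set)"
    by (simp add: complete_UNIV)
  fix e :: real assume "e > 0"
  then obtain n where n: "(1/2) ^ n < e"
    using real_arch_pow_inv[of e "1/2"] by auto
  define K where "K = (\<lambda>c. Abs_fps c :: 'a fps) ` (PiE {..n} (\<lambda>_. UNIV))"
  have "finite K"
    unfolding K_def by (intro finite_imageI finite_PiE) auto
  moreover have "f \<in> (\<Union>x\<in>K. ball x e)" for f
  proof
    show "Abs_fps (restrict (fps_nth f) {..n}) \<in> K"
      unfolding K_def by auto
    have "dist (Abs_fps (restrict (fps_nth f) {..n})) f < inverse (2 ^ n)"
      by (simp add: dist_less_eq_nth_equal)
    then show "f \<in> ball (Abs_fps (restrict (fps_nth f) {..n})) e"
      using n by (simp add: power_one_over inverse_eq_divide)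
  qed
  ultimately show "\<exists>k. finite k \<and> (UNIV :: 'a fps set) \<subseteq> (\<Union>x\<in>k. ball x e)"
    by blast
qed

text \<open>The power series, translated by \<open>f\<close>, form a compact set that contains the
  unit ball around \<open>f\<close>.\<close>

lemma locally_compact_fls:
  "locally_compact_space (euclidean :: 'a::{finite,comm_ring_1} fls topology)"
  unfolding locally_compact_space_def
proof safe
  fix f :: "'a fls"
  define \<phi> where "\<phi> = (\<lambda>s :: 'a fps. f + fps_to_fls s)"
  have "((\<lambda>s. fps_to_fls s) \<longlongrightarrow> fps_to_fls s) (at s)" for s :: "'a fps"
    unfolding tendsto_fls_iff
  proof
    fix n
    have "\<forall>\<^sub>F r in at s. dist r s < inverse (2 ^ nat n)"
      using tendstoD[OF tendsto_ident_at, of "inverse (2 ^ nat n)"] by simp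
    then show "\<forall>\<^sub>F r in at s. \<forall>j\<le>n. fps_to_fls r $$ j = fps_to_fls s $$ j"
      by eventually_elim (auto simp: dist_less_eq_nth_equal)
  qed
  then have "continuous_on UNIV \<phi>"
    unfolding \<phi>_def continuous_on_def by (auto intro!: tendsto_fls_add)
  then have "compact (range \<phi>)"
    using compact_fps_UNIV by (rule compact_continuous_image)
  moreover have "ball f 1 \<subseteq> range \<phi>"
  proof
    fix g assume "g \<in> ball f 1"
    \<comment> \<open>Distance below 1 means agreement at all indices up to 0, so
      \<open>g - f\<close> is a power series.\<close>
    then have "dist f g < 2 powi (- 0)" by simp
    then have eq: "\<forall>j\<le>0. f $$ j = g $$ j"
      by (simp only: dist_fls_less_iff)
    have "g = \<phi> (fls_regpart (g - f))"
      unfolding \<phi>_def by (rule fls_eqI) (use eq in auto)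
    then show "g \<in> range \<phi>" by blast
  qed
  ultimately show "\<exists>U K. openin euclidean U \<and> compactin euclidean K \<and> f \<in> U \<and> U \<subseteq> K"
    by (intro exI[of _ "ball f 1"] exI[of _ "range \<phi>"]) auto
qed

section \<open>A criterion for contraction groups on a metric type, and the group F_p((t))\<close>

lemma tdlc_contraction_group_euclideanI:
  fixes G :: "'a::metric_space cgroup" (structure)
  assumes "group G"
    and UNIV: "carrier G = UNIV" and top: "topol G = euclidean"
    and "continuous_on UNIV (\<lambda>(x, y). x \<otimes> y)"
    and "continuous_on UNIV (\<lambda>x. inv x)"
    and "locally_compact_space (euclidean :: 'a topology)"
    and conn: "\<And>S x y. connected (S :: 'a set) \<Longrightarrow> x \<in> S \<Longrightarrow> y \<in> S \<Longrightarrow> x = y"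
    and hom: "\<And>x y. aut G (x \<otimes> y) = aut G x \<otimes> aut G y"
    and cont: "continuous_on UNIV (aut G)" "continuous_on UNIV b"
    and inv: "\<And>x. b (aut G x) = x" "\<And>x. aut G (b x) = x"
    and "\<And>x. (\<lambda>n. (aut G ^^ n) x) \<longlonglongrightarrow> \<one>"
  shows "tdlc_contraction_group G"
proof -
  interpret group G by fact
  have bij: "bij (aut G)"
    using inv by (metis bijI')
  show ?thesis
  proof unfold_locales
    show "aut G \<in> iso G G"
      using bij hom by (auto simp: iso_def hom_def UNIV)
    have "homeomorphic_maps (topol G) (topol G) (aut G) b"
      using cont inv by (simp add: homeomorphic_maps_def top)
    then show "homeomorphic_map (topol G) (topol G) (aut G)"
      by (rule homeomorphic_maps_imp_map)
    have "connected_component_of_set euclidean x = {x}" for x :: 'a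
      unfolding connected_component_of_def using conn
      by (auto intro: exI[of _ "{x}"])
    then show "totally_disconnected_space (topol G)"
      by (simp add: totally_disconnected_space_def top)
  qed (use assms(4-6,13) in \<open>simp_all add: UNIV top\<close>)
qed

lemma fls_X_mult_inverse:
  fixes f :: "'a::comm_ring_1 fls"
  shows "fls_X * fls_shift 1 f = f" "fls_shift 1 (fls_X * f) = f"
  by (simp_all add: fls_X_times_conv_shift)

lemma continuous_on_fls_shift_fls_X:
  shows "continuous_on UNIV (fls_shift k :: 'a::comm_ring_1 fls \<Rightarrow> _)"
    and "continuous_on UNIV (\<lambda>f :: 'a::comm_ring_1 fls. fls_X * f)"
  unfolding continuous_on_def fls_X_times_conv_shift
  by (auto intro!: tendsto_fls_shift)

lemma funpow_fls_X_mult: "((\<lambda>f :: 'a::comm_ring_1 fls. fls_X * f) ^^ n) f = fls_X ^ n * f"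
  by (induction n) (simp_all add: mult.assoc)

lemma tdlc_Fp_laurent: "tdlc_contraction_group (Fp_laurent :: 'p::prime_card mod_ring fls cgroup)"
proof -
  let ?G = "Fp_laurent :: 'p mod_ring fls cgroup"
  have grp: "group ?G"
    by (rule groupI) (auto simp: Fp_laurent_def add.assoc intro: exI[of _ "- x" for x])
  then interpret group ?G .
  have "inv\<^bsub>?G\<^esub> f = - f" for f
    by (rule inv_equality) (auto simp: Fp_laurent_def)
  then have inv: "m_inv ?G = uminus" by auto
  show ?thesis
  proof (rule tdlc_contraction_group_euclideanI[where b = "fls_shift 1"])
    show "continuous_on UNIV (\<lambda>(x, y). x \<otimes>\<^bsub>?G\<^esub> y)"
      unfolding continuous_on_def case_prod_beta'
      by (simp add: Fp_laurent_def tendsto_fls_add tendsto_fst tendsto_snd)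
    show "continuous_on UNIV (m_inv ?G)"
      unfolding inv continuous_on_def by (auto intro!: tendsto_fls_minus)
    show "(\<lambda>n. (aut ?G ^^ n) x) \<longlonglongrightarrow> \<one>\<^bsub>?G\<^esub>" for x
      by (simp add: Fp_laurent_def funpow_fls_X_mult tendsto_fls_X_power_mult)
  qed (use grp locally_compact_fls connected_fls_eq continuous_on_fls_shift_fls_X in
      \<open>auto simp: Fp_laurent_def fls_X_mult_inverse distrib_left\<close>)
qed

section \<open>The coefficientwise product\<close>

definition fls_hadamard :: "'a::mult_zero fls \<Rightarrow> 'a fls \<Rightarrow> 'a fls" where
  "fls_hadamard f g = Abs_fls (\<lambda>n. f $$ n * g $$ n)"

lemma fls_hadamard_nth [simp]: "fls_hadamard f g $$ n = f $$ n * g $$ n"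
  unfolding fls_hadamard_def
  by (rule nth_Abs_fls_lower_bound[of "fls_subdegree f"]) auto

lemma fls_hadamard_0 [simp]: "fls_hadamard 0 g = 0" "fls_hadamard f 0 = 0"
  by (auto intro: fls_eqI)

lemma fls_hadamard_add:
  fixes f g h :: "'a::ring fls"
  shows "fls_hadamard (f + g) h = fls_hadamard f h + fls_hadamard g h"
    and "fls_hadamard h (f + g) = fls_hadamard h f + fls_hadamard h g"
  by (auto intro!: fls_eqI simp: algebra_simps)

lemma fls_hadamard_minus:
  fixes f g :: "'a::ring fls"
  shows "fls_hadamard (- f) g = - fls_hadamard f g" "fls_hadamard f (- g) = - fls_hadamard f g"
  by (auto intro!: fls_eqI)

text \<open>Both coefficient sequences are shifted alike. This is what makes the coordinatewise
  shift an automorphism of the extensions.\<close>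

lemma fls_hadamard_fls_X_mult:
  fixes f g :: "'a::comm_ring_1 fls"
  shows "fls_hadamard (fls_X * f) (fls_X * g) = fls_X * fls_hadamard f g"
  by (auto intro!: fls_eqI simp: fls_X_times_conv_shift)

lemma tendsto_fls_hadamard:
  fixes h k :: "'b \<Rightarrow> 'a::ring fls"
  assumes "(h \<longlongrightarrow> a) F" "(k \<longlongrightarrow> b) F"
  shows "((\<lambda>x. fls_hadamard (h x) (k x)) \<longlongrightarrow> fls_hadamard a b) F"
  unfolding tendsto_fls_iff
proof
  fix n
  have "\<forall>\<^sub>F x in F. \<forall>j\<le>n. h x $$ j = a $$ j" "\<forall>\<^sub>F x in F. \<forall>j\<le>n. k x $$ j = b $$ j"
    using assms by (auto simp: tendsto_fls_iff)
  then show "\<forall>\<^sub>F x in F. \<forall>j\<le>n. fls_hadamard (h x) (k x) $$ j = fls_hadamard a b $$ j"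
    by eventually_elim simp
qed

section \<open>The extensions\<close>

definition hadamard_ext :: "'a::comm_ring_1 fps \<Rightarrow> ('a fls \<times> 'a fls) cgroup" where
  "hadamard_ext s =
     \<lparr>carrier = UNIV,
      monoid.mult = (\<lambda>(x, f) (y, g). (x + y + fls_hadamard (fps_to_fls s * f) g, f + g)),
      one = (0, 0), topol = euclidean, aut = (\<lambda>(x, f). (fls_X * x, fls_X * f))\<rparr>"

lemma hadamard_ext_simps [simp]:
  "carrier (hadamard_ext s) = UNIV"
  "(x, f) \<otimes>\<^bsub>hadamard_ext s\<^esub> (y, g) = (x + y + fls_hadamard (fps_to_fls s * f) g, f + g)"
  "\<one>\<^bsub>hadamard_ext s\<^esub> = (0, 0)"
  "topol (hadamard_ext s) = euclidean"
  "aut (hadamard_ext s) (x, f) = (fls_X * x, fls_X * f)"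
  by (simp_all add: hadamard_ext_def)

lemma group_hadamard_ext: "group (hadamard_ext s)"
proof (rule groupI)
  fix a :: "'a fls \<times> 'a fls"
  obtain x f where a: "a = (x, f)" by fastforce
  show "\<exists>b\<in>carrier (hadamard_ext s). b \<otimes>\<^bsub>hadamard_ext s\<^esub> a = \<one>\<^bsub>hadamard_ext s\<^esub>"
    by (rule bexI[of _ "(fls_hadamard (fps_to_fls s * f) f - x, - f)"])
      (auto simp: a fls_hadamard_minus)
qed (auto simp: fls_hadamard_add algebra_simps)

lemma inv_hadamard_ext:
  "inv\<^bsub>hadamard_ext s\<^esub> (x, f) = (fls_hadamard (fps_to_fls s * f) f + - x, - f)"
  by (rule group.inv_equality[OF group_hadamard_ext]) (auto simp: fls_hadamard_minus)

text \<open>As a space the group is a product of two copies of the Laurent series, which gives local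
  compactness and total disconnectedness; the cocycle is continuous because each of its operations
  is.\<close>

lemma tdlc_hadamard_ext:
  "tdlc_contraction_group (hadamard_ext (s :: 'a::{finite,comm_ring_1} fps))"
proof (rule tdlc_contraction_group_euclideanI[where b = "map_prod (fls_shift 1) (fls_shift 1)"])
  let ?G = "hadamard_ext s"
  have eqs: "(\<lambda>(a, b). a \<otimes>\<^bsub>?G\<^esub> b) = (\<lambda>p. (fst (fst p) + fst (snd p) +
      fls_hadamard (fps_to_fls s * snd (fst p)) (snd (snd p)), snd (fst p) + snd (snd p)))"
    "m_inv ?G = (\<lambda>p. (fls_hadamard (fps_to_fls s * snd p) (snd p) + - fst p, - snd p))"
    "aut ?G = map_prod (\<lambda>f. fls_X * f) (\<lambda>f. fls_X * f)"
    by (auto simp: inv_hadamard_ext fun_eq_iff)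
  show "group ?G" by (rule group_hadamard_ext)
  show "continuous_on UNIV (\<lambda>(a, b). a \<otimes>\<^bsub>?G\<^esub> b)"
    unfolding continuous_on_def eqs
    by (intro ballI tendsto_Pair tendsto_fls_add tendsto_fls_hadamard tendsto_fls_fps_mult
        tendsto_fst tendsto_snd tendsto_ident_at)
  show "continuous_on UNIV (m_inv ?G)"
    unfolding continuous_on_def eqs
    by (intro ballI tendsto_Pair tendsto_fls_add tendsto_fls_minus tendsto_fls_hadamard
        tendsto_fls_fps_mult tendsto_fst tendsto_snd tendsto_ident_at)
  show "locally_compact_space (euclidean :: ('a fls \<times> 'a fls) topology)"
    unfolding prod_topology_euclidean[symmetric] locally_compact_space_prod_topology
    by (simp add: locally_compact_fls)
  show "a = b" if "connected S" "a \<in> S" "b \<in> S" for S and a b :: "'a fls \<times> 'a fls"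
  proof (rule prod_eqI)
    have "connected (fst ` S)" "connected (snd ` S)"
      using that by (auto intro!: connected_continuous_image continuous_intros)
    then show "fst a = fst b" "snd a = snd b"
      using that by (auto intro: connected_fls_eq)
  qed
  show "aut ?G (a \<otimes>\<^bsub>?G\<^esub> b) = aut ?G a \<otimes>\<^bsub>?G\<^esub> aut ?G b" for a b
    by (cases a, cases b)
      (simp add: distrib_left mult.left_commute[of _ fls_X] fls_hadamard_fls_X_mult)
  have cont: "continuous_on UNIV (map_prod k k)"
    if "continuous_on UNIV k" for k :: "'a fls \<Rightarrow> 'a fls"
    unfolding map_prod_def case_prod_beta
    by (intro continuous_intros continuous_on_compose2[OF that]) auto
  show "continuous_on UNIV (aut ?G)"
    "continuous_on UNIV (map_prod (fls_shift 1 :: 'a fls \<Rightarrow> _) (fls_shift 1 :: 'a fls \<Rightarrow> _))"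
    unfolding eqs by (intro cont continuous_on_fls_shift_fls_X)+
  have "(aut ?G ^^ n) (x, f) = (fls_X ^ n * x, fls_X ^ n * f)" for n x f
    by (induction n) (simp_all add: mult.assoc)
  then show "(\<lambda>n. (aut ?G ^^ n) a) \<longlonglongrightarrow> \<one>\<^bsub>?G\<^esub>" for a
    by (cases a) (auto intro!: tendsto_Pair tendsto_fls_X_power_mult)
qed (auto simp: fls_X_mult_inverse)

text \<open>The cocycle vanishes once either argument is 0, so the elements \<open>(x, 0)\<close>
  commute with everything.\<close>

lemma central_extension_hadamard_ext:
  fixes s :: "'p::prime_card mod_ring fps"
  shows "central_cgroup_extension Fp_laurent (hadamard_ext s) Fp_laurent (\<lambda>x. (x, 0)) snd"
proof -
  have "continuous_on UNIV (\<lambda>x :: 'p mod_ring fls. (x, 0 :: 'p mod_ring fls))"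
    "continuous_on UNIV (snd :: 'p mod_ring fls \<times> 'p mod_ring fls \<Rightarrow> _)"
    by (intro continuous_intros)+
  moreover have "kernel (hadamard_ext s) Fp_laurent snd = range (\<lambda>x. (x, 0))"
    by (auto simp: kernel_def Fp_laurent_def)
  ultimately show ?thesis
    unfolding central_cgroup_extension_def cgroup_extension_def cgroup_morphism_def
    using tdlc_Fp_laurent tdlc_hadamard_ext[of s]
    by (auto simp: Fp_laurent_def hom_def inj_on_def group_center_def add.commute)
qed

section \<open>Isomorphisms between the extensions\<close>

text \<open>Commuting with \<open>(0, t^m)\<close> and reading coefficient \<open>m\<close> gives
  \<open>(s f)_m = s_0 f_m = 0\<close>. Hence \<open>s f = 0\<close>, and there are no zero
  divisors.\<close>

lemma hadamard_ext_central:
  fixes s :: "'a::idom fps"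
  assumes "s $ 0 = 0" "s \<noteq> 0"
    and comm: "\<And>b. (x, f) \<otimes>\<^bsub>hadamard_ext s\<^esub> b = b \<otimes>\<^bsub>hadamard_ext s\<^esub> (x, f)"
  shows "f = 0"
proof -
  have "(fps_to_fls s * f) $$ m = 0" for m
  proof -
    define g :: "'a fls" where "g = fls_X_intpow m"
    have "fls_hadamard (fps_to_fls s * f) g = fls_hadamard (fps_to_fls s * g) f"
      using comm[of "(0, g)"] by simp
    then have "fls_hadamard (fps_to_fls s * f) g $$ m = fls_hadamard (fps_to_fls s * g) f $$ m"
      by simp
    then show ?thesis
      using assms(1) by (simp add: g_def fls_shifted_times_simps)
  qed
  then have "fps_to_fls s * f = 0"
    by (intro fls_eqI) simp
  then show ?thesis
    using assms(2) by (simp only: mult_eq_0_iff fps_to_fls_eq_0_iff) simp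
qed

text \<open>The equations are sorted by the offset of \<open>m - n\<close> from the order of
  \<open>v\<close>. Offsets 0 and 1, with the gap of \<open>s\<close> and \<open>r\<close> in
  degrees 2 and 3, kill all but the leading coefficient of \<open>v\<close>; offset 0 then compares
  \<open>s\<close> with \<open>r\<close>.\<close>

lemma rescaling_trivial:
  fixes s r :: "'a::field fps" and u v :: "'a fls"
  assumes s: "s $ 0 = 0" "s $ 1 = 1" "s $ 2 = 0" "s $ 3 = 0"
    and r: "r $ 0 = 0" "r $ 1 = 1" "r $ 2 = 0" "r $ 3 = 0"
    and "v \<noteq> 0"
    and eq: "\<And>n m. n \<ge> 1 \<Longrightarrow> (fps_to_fls r * v) $$ m * v $$ (m - int n) =
      s $ n * u $$ (m - int n) + (fps_to_fls r * v) $$ (m - int n) * v $$ m"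
  shows "s = r"
proof -
  \<comment> \<open>Normalisation \<open>v = t^d a\<close> with \<open>a $ 0\<close> nonzero, and
    \<open>r v = t^d w\<close>; \<open>c\<close> reads \<open>u\<close> from index \<open>d\<close>
    on.\<close>
  define d where "d = fls_subdegree v"
  define a where "a = fls_base_factor_to_fps v"
  define w where "w = r * a"
  define c where "c j = u $$ (d + int j)" for j
  have a0: "a $ 0 \<noteq> 0"
    using \<open>v \<noteq> 0\<close> by (simp add: a_def)
  have v: "v = fls_shift (- d) (fps_to_fls a)"
    unfolding a_def d_def by (rule fls_conv_base_factor_to_fps_shift_subdegree)
  have rv: "fps_to_fls r * v = fls_shift (- d) (fps_to_fls w)"
    by (simp add: v w_def fls_shifted_times_simps fls_times_fps_to_fls)
  have key: "w $ (n + j) * a $ j = s $ n * c j + w $ j * a $ (n + j)" if "n \<ge> 1" for n j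
  proof -
    have "d + int (n + j) - int n = d + int j" by simp
    from eq[OF that, of "d + int (n + j)", unfolded this] show ?thesis
      unfolding rv c_def by (simp add: v del: of_nat_add)
  qed
  \<comment> \<open>Up to degree 3 the series \<open>r\<close> is just \<open>t\<close>, so
    \<open>w\<close> begins as \<open>a\<close> shifted by one.\<close>
  have w: "w $ 0 = 0" "w $ 1 = a $ 0" "w $ 2 = a $ 1" "w $ 3 = a $ 2"
    using r by (simp_all add: w_def fps_mult_nth numeral_2_eq_2 numeral_3_eq_3)
  have c0: "c 0 = a $ 0 * a $ 0"
    using key[of 1 0] w s by simp
  \<comment> \<open>At offset 0 the last term vanishes with \<open>w $ 0\<close>, and
    \<open>s $ 2 = s $ 3 = 0\<close> leaves
    \<open>a $ 1 * a $ 0 = a $ 2 * a $ 0 = 0\<close>.\<close>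
  have a1: "a $ 1 = 0" and a2: "a $ 2 = 0"
    using key[of 2 0] key[of 3 0] w s a0 by simp_all
  have "c 1 = 0"
    using key[of 1 1] w s a1 a2 by (simp add: numeral_2_eq_2)
  \<comment> \<open>With \<open>a $ 1\<close> and \<open>c 1\<close> gone, offset 1 reads
    \<open>0 = a $ 0 * a $ (n + 1)\<close>. It is available for \<open>n \<ge> 1\<close> only, hence
    the case split.\<close>
  have "a $ Suc n = 0" for n
  proof (cases "n = 0")
    case False
    then show ?thesis
      using key[of n 1] w a0 a1 \<open>c 1 = 0\<close> by simp
  qed (use a1 in simp)
  then have "a = fps_const (a $ 0)"
    by (intro fps_ext) (metis fps_nth_fps_const not0_implies_Suc)
  then have wn: "w $ n = r $ n * a $ 0" for n
    unfolding w_def by (metis fps_mult_right_const_nth)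
  show ?thesis
  proof (rule fps_ext)
    fix n
    show "s $ n = r $ n"
    proof (cases "n = 0")
      case False
      then show ?thesis
        \<comment> \<open>Offset 0 is now
          \<open>r $ n * a $ 0 * a $ 0 = s $ n * a $ 0 * a $ 0\<close>.\<close>
        using key[of n 0] a0 c0 wn[of n] w by simp
    qed (simp add: s r)
  qed
qed

text \<open>The map induced on the centre is additive and commutes with \<open>t\<close>, but is not
  assumed linear over the coefficients. Coefficients 0 and 1 in \<open>s\<close> still let the image
  of \<open>s_n t^n\<close> be computed from that of 1.\<close>

lemma hadamard_ext_isomorphic_imp_eq:
  fixes s r :: "'a::field fps"
  assumes iso: "cgroup_isomorphic (hadamard_ext s) (hadamard_ext r)"
    and s: "s $ 0 = 0" "s $ 1 = 1" "s $ 2 = 0" "s $ 3 = 0"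
    and r: "r $ 0 = 0" "r $ 1 = 1" "r $ 2 = 0" "r $ 3 = 0"
    and s01: "\<And>n. s $ n \<in> {0, 1}"
  shows "s = r"
proof -
  let ?G = "hadamard_ext s" and ?H = "hadamard_ext r"
  obtain \<phi> \<psi> where mor: "cgroup_morphism ?G ?H \<phi>" and inv: "\<And>a. \<psi> (\<phi> a) = a" "\<And>b. \<phi> (\<psi> b) = b"
    using iso by (auto simp: cgroup_isomorphic_def)
  have hom: "\<phi> (a \<otimes>\<^bsub>?G\<^esub> b) = \<phi> a \<otimes>\<^bsub>?H\<^esub> \<phi> b" for a b
    using mor by (simp add: cgroup_morphism_def hom_def del: hadamard_ext_simps(2) split_paired_All)
  have equi: "\<phi> (fls_X * x, fls_X * f) = aut ?H (\<phi> (x, f))" for x f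
    using mor by (simp add: cgroup_morphism_def)
  have nz: "s \<noteq> 0" "r \<noteq> 0"
    using s r by auto
  \<comment> \<open>Every element of the target is some \<open>\<phi> (\<psi> b)\<close>, so
    \<open>\<phi>\<close> carries central elements to central ones.\<close>
  have "snd (\<phi> (x, 0)) = 0" for x
  proof (rule hadamard_ext_central[OF r(1) nz(2)])
    fix b
    have "(x, 0) \<otimes>\<^bsub>?G\<^esub> \<psi> b = \<psi> b \<otimes>\<^bsub>?G\<^esub> (x, 0)"
      by (cases "\<psi> b") (simp add: add.commute)
    then have "\<phi> (x, 0) \<otimes>\<^bsub>?H\<^esub> \<phi> (\<psi> b) = \<phi> (\<psi> b) \<otimes>\<^bsub>?H\<^esub> \<phi> (x, 0)"
      by (metis hom)
    then show "(fst (\<phi> (x, 0)), snd (\<phi> (x, 0))) \<otimes>\<^bsub>?H\<^esub> b =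
        b \<otimes>\<^bsub>?H\<^esub> (fst (\<phi> (x, 0)), snd (\<phi> (x, 0)))"
      by (simp add: inv)
  qed
  then have center: "\<phi> (x, 0) = (fst (\<phi> (x, 0)), 0)" for x
    by (metis prod.collapse)
  define u where "u = fst (\<phi> (1, 0))"
  define v where "v = snd (\<phi> (0, 1))"
  have un: "\<phi> (fls_X ^ n, 0) = (fls_X ^ n * u, 0)" for n
  proof (induction n)
    case 0
    show ?case using center[of 1] by (simp add: u_def)
  next
    case (Suc n)
    then show ?case using equi[of "fls_X ^ n" 0] by (simp add: mult.assoc)
  qed
  have vn: "snd (\<phi> (0, fls_X ^ n)) = fls_X ^ n * v" for n
  proof (induction n)
    case (Suc n)
    then show ?case
      using equi[of 0 "fls_X ^ n"] by (cases "\<phi> (0, fls_X ^ n)") (simp add: mult.assoc)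
  qed (simp add: v_def)
  \<comment> \<open>Otherwise \<open>\<phi> (0, 1)\<close> would be central, and by injectivity of
    \<open>\<phi>\<close> so would \<open>(0, 1)\<close>.\<close>
  have "v \<noteq> 0"
  proof
    assume "v = 0"
    then obtain w where w: "\<phi> (0, 1) = (w, 0)"
      by (metis prod.collapse v_def)
    have "(0, 1) \<otimes>\<^bsub>?G\<^esub> b = b \<otimes>\<^bsub>?G\<^esub> (0, 1)" for b
    proof -
      have "(w, 0) \<otimes>\<^bsub>?H\<^esub> \<phi> b = \<phi> b \<otimes>\<^bsub>?H\<^esub> (w, 0)"
        by (cases "\<phi> b") (simp add: add.commute)
      then have "\<phi> ((0, 1) \<otimes>\<^bsub>?G\<^esub> b) = \<phi> (b \<otimes>\<^bsub>?G\<^esub> (0, 1))"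
        by (simp only: hom w)
      then show ?thesis
        by (metis inv(1))
    qed
    then have "(1 :: 'a fls) = 0"
      by (rule hadamard_ext_central[OF s(1) nz(1)])
    then show False by simp
  qed
  have eq: "fls_hadamard (fps_to_fls r * v) (fls_X ^ n * v) =
      fls_const (s $ n) * (fls_X ^ n * u) + fls_hadamard (fps_to_fls r * (fls_X ^ n * v)) v"
    if "n \<ge> 1" for n
  proof -
    \<comment> \<open>The central element \<open>(?z, 0)\<close> is the commutator of
      \<open>(0, 1)\<close> and \<open>(0, t^n)\<close>: one order contributes
      \<open>s_n t^n\<close>, the other nothing, since \<open>s t^n\<close> has no constant term for
      \<open>n \<ge> 1\<close>.\<close>
    let ?z = "fls_const (s $ n) * fls_X ^ n"
    have "fls_hadamard (fps_to_fls s * 1) (fls_X ^ n) = ?z"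
      by (auto intro!: fls_eqI)
    moreover have "fls_hadamard (fps_to_fls s * fls_X ^ n) 1 = 0"
      using that by (auto intro!: fls_eqI simp: fls_X_power_times_conv_shift)
    ultimately have "(0, 1) \<otimes>\<^bsub>?G\<^esub> (0, fls_X ^ n) = (?z, 0) \<otimes>\<^bsub>?G\<^esub> ((0, fls_X ^ n) \<otimes>\<^bsub>?G\<^esub> (0, 1))"
      by (simp add: add.commute)
    then have *: "\<phi> (0, 1) \<otimes>\<^bsub>?H\<^esub> \<phi> (0, fls_X ^ n) =
        \<phi> (?z, 0) \<otimes>\<^bsub>?H\<^esub> (\<phi> (0, fls_X ^ n) \<otimes>\<^bsub>?H\<^esub> \<phi> (0, 1))"
      by (metis hom)
    have "\<phi> (0, 0) = (0, 0)"
      using hom[of "(0, 0)" "(0, 0)"] center[of 0] by (cases "\<phi> (0, 0)") auto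
    then have z: "\<phi> (?z, 0) = (fls_const (s $ n) * (fls_X ^ n * u), 0)"
      using s01[of n] un[of n] by auto
    show ?thesis
      \<comment> \<open>In first coordinates, the unknown first components of both images occur on
        both sides and cancel.\<close>
      using * vn[of n] unfolding z v_def
      by (cases "\<phi> (0, 1)", cases "\<phi> (0, fls_X ^ n)") (simp add: algebra_simps)
  qed
  show ?thesis
  proof (rule rescaling_trivial[OF s r \<open>v \<noteq> 0\<close>])
    fix n :: nat and m :: int
    assume "n \<ge> 1"
    from arg_cong[OF eq[OF this], of "\<lambda>f. f $$ m"]
    show "(fps_to_fls r * v) $$ m * v $$ (m - int n) =
        s $ n * u $$ (m - int n) + (fps_to_fls r * v) $$ (m - int n) * v $$ m"
      by (simp add: fls_X_power_times_conv_shift fls_shifted_times_simps)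
  qed
qed

section \<open>The uncountable family\<close>

text \<open>The series \<open>t\<close> plus the sum of \<open>t^(k+4)\<close> over \<open>k\<close>
  in \<open>A\<close>: the offset 4 keeps the degrees 2 and 3 empty, as the rigidity argument
  requires.\<close>

definition subset_series :: "nat set \<Rightarrow> 'a::comm_ring_1 fps" where
  "subset_series A = Abs_fps (\<lambda>n. if n = 1 \<or> (n \<ge> 4 \<and> n - 4 \<in> A) then 1 else 0)"

lemma subset_series_inject:
  assumes "subset_series A = (subset_series B :: 'a::comm_ring_1 fps)"
  shows "A = B"
proof -
  have "n \<in> A \<longleftrightarrow> subset_series A $ (n + 4) = (1 :: 'a)" for n A
    by (simp add: subset_series_def)
  then show ?thesis using assms by auto
qed

lemma uncountable_nat_sets: "uncountable (UNIV :: nat set set)"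
  by (metis Cantors_theorem Pow_UNIV range_from_nat_into UNIV_not_empty)

theorem theoremB:
  shows "\<exists>S :: ('p::prime_card mod_ring fls \<times> 'p mod_ring fls) cgroup set.
    uncountable S \<and>
    pairwise (\<lambda>H K. \<not> cgroup_isomorphic H K) S \<and>
    (\<forall>H \<in> S. tdlc_contraction_group H \<and>
      (\<exists>\<iota> q. central_cgroup_extension
        (Fp_laurent :: 'p mod_ring fls cgroup) H (Fp_laurent :: 'p mod_ring fls cgroup) \<iota> q))"
proof -
  define E :: "nat set \<Rightarrow> ('p mod_ring fls \<times> 'p mod_ring fls) cgroup"
    where "E A = hadamard_ext (subset_series A)" for A
  have eq: "A = B" if "cgroup_isomorphic (E A) (E B)" for A B
    using that unfolding E_def
    by (intro subset_series_inject[where 'a = "'p mod_ring"] hadamard_ext_isomorphic_imp_eq)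
      (auto simp: subset_series_def)
  \<comment> \<open>Reflexivity turns equality of two groups into an isomorphism, so that
    \<open>eq\<close> also shows \<open>E\<close> to be injective.\<close>
  have refl: "cgroup_isomorphic (E A) (E A)" for A
    unfolding cgroup_isomorphic_def cgroup_morphism_def
    by (intro exI[of _ "\<lambda>x. x"]) (auto simp: hom_def)
  have "inj E"
    by (rule injI) (metis eq refl)
  then have "uncountable (range E)"
    using uncountable_nat_sets by (metis countable_image_inj_on)
  moreover have "pairwise (\<lambda>H K. \<not> cgroup_isomorphic H K) (range E)"
    unfolding pairwise_def using eq by blast
  ultimately show ?thesis
    using central_extension_hadamard_ext tdlc_hadamard_ext unfolding E_def by blast
qed

end
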